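(* Let $\mathscr{A}=(\mathscr{A},f,g)$ be a commutative Krasner $(m,n)$-hyperring with scalar identity $1_{\mathscr{A}}$, let $P$ be a proper hyperideal of $\mathscr{A}$, let $Q$ be a minimal $n$-ary prime hyperideal of $\mathscr{A}$ (minimal with respect to inclusion among all $n$-ary prime hyperideals of $\mathscr{A}$), and let $S=\mathscr{A}\setminus Q$. Then $P$ is an $n$-ary $S$-hyperideal of $\mathscr{A}$ if and only if $P$ is an $n$-ary $Q$-primary hyperideal of $\mathscr{A}$.
   Context: Let $m,n\ge 2$. Notation: $p_i^j$ denotes the sequence $p_i,\dots,p_j$ (empty if $j<i$); $p^{(k)}$ denotes $p$ repeated $k$ times; for non-empty subsets, $f(P_1^m)=\bigcup\{f(p_1^m)\mid p_i\in P_i\}$ and similarly for $g$; singletons are identified with elements. A canonical $m$-ary hypergroup $(\mathscr{A},f)$ is a set with $f:\mathscr{A}^m\to\{\text{non-empty subsets of }\mathscr{A}\}$ such that: $f$ is associative ($f(p_1^{i-1},f(p_i^{m+i-1}),p_{m+i}^{2m-1})$ is independent of $i$) and invariant under permutations of its arguments; there is a unique $0$ with $f(p,0^{(m-1)})=\{p\}$ for all $p$; each $p$ has a unique $-p$ with $0\in f(p,-p,0^{(m-2)})$; and $p\in f(p_1^m)$ implies $p_i\in f(p,-p_1,\dots,-p_{i-1},-p_{i+1},\dots,-p_m)$ for each $i$. A commutative Krasner $(m,n)$-hyperring with scalar identity $1_{\mathscr{A}}$ is $(\mathscr{A},f,g)$ with $(\mathscr{A},f)$ a canonical $m$-ary hypergroup,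 $g:\mathscr{A}^n\to\mathscr{A}$ an associative operation invariant under permutations of its arguments, $g$ distributive over $f$ in each argument ($g(p_1^{i-1},f(q_1^m),p_{i+1}^n)=f(g(p_1^{i-1},q_1,p_{i+1}^n),\dots,g(p_1^{i-1},q_m,p_{i+1}^n))$), $g(0,p_2^n)=0$, and $g(p,1_{\mathscr{A}}^{(n-1)})=p$ for all $p$. A hyperideal is a non-empty $P\subseteq\mathscr{A}$ with $f(p_1^m)\subseteq P$ and $-p\in P$ for all $p,p_1,\dots,p_m\in P$, and $g(p_1^{i-1},P,p_{i+1}^n)\subseteq P$ for all $p_j\in\mathscr{A}$ and all $i$; it is proper if $P\ne\mathscr{A}$. A proper hyperideal $P$ is $n$-ary prime if $g(p_1^n)\in P$ implies $p_i\in P$ for some $i$. The radical ${\bf r}(P)$ is the intersection of all $n$-ary prime hyperideals containing $P$ (and ${\bf r}(P)=\mathscr{A}$ if there are none). An $n$-ary multiplicative subset is a non-empty $S\subseteq\mathscr{A}$ with $g(s_1^n)\in S$ for all $s_1,\dots,s_n\in S$ (e.g. the complement of an $n$-ary prime hyperideal). Given such $S$, an $n$-ary $S$-hyperideal is a proper hyperideal $P$ such that whenever $g(p_1^n)\in P$ with $p_1,\dots,p_n\in\mathscr{A}$ and $p_i\in S$ for some $i$, then $g(p_1^{i-1},1_{\mathscr{A}},p_{i+1}^n)\in P$. A proper hyperideal $P$ is $n$-ary primary if $g(p_1^n)\in P$ with $p_1,\dots,p_n\in\mathscr{A}$ implies that $p_i\in P$ or $g(p_1^{i-1},1_{\mathscr{A}},p_{i+1}^n)\in{\bf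 r}(P)$ for some $1\le i\le n$. The radical of an $n$-ary primary hyperideal is an $n$-ary prime hyperideal; $P$ is called $n$-ary $Q$-primary if it is $n$-ary primary and ${\bf r}(P)=Q$.
   Formalization: In the definition of n-ary primary, "for some i" is replaced by "for every i" (g(p_1^n) in P and p_i not in P imply g(p_1^{i-1},1,p_{i+1}^n) in r(P)); with the literal "for some i" the claim fails, e.g. for P=0, Q=(x) in k[x,y]/(x^2,xy). *)

theory Defs
  imports Main "HOL-Library.Multiset"
begin

text \<open>
  A $k$-ary (hyper)operation on a set \<open>A\<close> is a function on lists, of which only the
  values on lists of length \<open>k\<close> with entries in \<open>A\<close> matter. Positions in a
  tuple are counted from 0, so the entry $p_i$ of the tuple \<open>ps\<close> is \<open>ps ! (i - 1)\<close>.
  The tuple $p_1^{i-1}, x, p_{i+1}^n$ is a list update; the entry of the list it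
  overwrites is irrelevant.
\<close>

definition tuples :: "nat \<Rightarrow> 'a set \<Rightarrow> 'a list set" where
  "tuples k A = {xs. length xs = k \<and> set xs \<subseteq> A}"

definition hyper_ext :: "('a list \<Rightarrow> 'a set) \<Rightarrow> 'a set list \<Rightarrow> 'a set" where
  "hyper_ext f Ps = (\<Union>ps \<in> listset Ps. f ps)"

definition is_hzero :: "nat \<Rightarrow> 'a set \<Rightarrow> ('a list \<Rightarrow> 'a set) \<Rightarrow> 'a \<Rightarrow> bool" where
  "is_hzero m A f z \<longleftrightarrow> z \<in> A \<and> (\<forall>p\<in>A. f (p # replicate (m - 1) z) = {p})"

definition hzero :: "nat \<Rightarrow> 'a set \<Rightarrow> ('a list \<Rightarrow> 'a set) \<Rightarrow> 'a" where
  "hzero m A f = (THE z. is_hzero m A f z)"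

definition is_hneg :: "nat \<Rightarrow> 'a set \<Rightarrow> ('a list \<Rightarrow> 'a set) \<Rightarrow> 'a \<Rightarrow> 'a \<Rightarrow> bool" where
  "is_hneg m A f p q \<longleftrightarrow>
     q \<in> A \<and> hzero m A f \<in> f (p # q # replicate (m - 2) (hzero m A f))"

definition hneg :: "nat \<Rightarrow> 'a set \<Rightarrow> ('a list \<Rightarrow> 'a set) \<Rightarrow> 'a \<Rightarrow> 'a" where
  "hneg m A f p = (THE q. is_hneg m A f p q)"

locale canonical_hypergroup =
  fixes m :: nat and A :: "'a set" and f :: "'a list \<Rightarrow> 'a set"
  assumes m_ge_2: "m \<ge> 2"
    and f_closed: "ps \<in> tuples m A \<Longrightarrow> f ps \<noteq> {} \<and> f ps \<subseteq> A"
    and f_assoc: "\<lbrakk>ps \<in> tuples (2 * m - 1) A; i < m; j < m\<rbrakk> \<Longrightarrow>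
      hyper_ext f (map (\<lambda>x. {x}) (take i ps) @ [f (take m (drop i ps))]
                   @ map (\<lambda>x. {x}) (drop (i + m) ps))
      = hyper_ext f (map (\<lambda>x. {x}) (take j ps) @ [f (take m (drop j ps))]
                   @ map (\<lambda>x. {x}) (drop (j + m) ps))"
    and f_perm: "\<lbrakk>ps \<in> tuples m A; mset qs = mset ps\<rbrakk> \<Longrightarrow> f qs = f ps"
    and zero_ex1: "\<exists>!z. is_hzero m A f z"
    and neg_ex1: "p \<in> A \<Longrightarrow> \<exists>!q. is_hneg m A f p q"
    and f_reversible: "\<lbrakk>ps \<in> tuples m A; p \<in> f ps; i < m\<rbrakk> \<Longrightarrow>
      ps ! i \<in> f (p # map (hneg m A f) (take i ps @ drop (Suc i) ps))"

locale comm_krasner_hyperring = canonical_hypergroup m A f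
  for m :: nat and n :: nat and A :: "'a set" and f :: "'a list \<Rightarrow> 'a set"
    and g :: "'a list \<Rightarrow> 'a" and one :: 'a +
  assumes n_ge_2: "n \<ge> 2"
    and g_closed: "ps \<in> tuples n A \<Longrightarrow> g ps \<in> A"
    and g_assoc: "\<lbrakk>ps \<in> tuples (2 * n - 1) A; i < n; j < n\<rbrakk> \<Longrightarrow>
      g (take i ps @ [g (take n (drop i ps))] @ drop (i + n) ps)
      = g (take j ps @ [g (take n (drop j ps))] @ drop (j + n) ps)"
    and g_perm: "\<lbrakk>ps \<in> tuples n A; mset qs = mset ps\<rbrakk> \<Longrightarrow> g qs = g ps"
    and g_distrib: "\<lbrakk>ps \<in> tuples n A; qs \<in> tuples m A; i < n\<rbrakk> \<Longrightarrow>
      (\<lambda>x. g (ps[i := x])) ` f qs = f (map (\<lambda>q. g (ps[i := q])) qs)"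
    and g_zero: "ps \<in> tuples (n - 1) A \<Longrightarrow> g (hzero m A f # ps) = hzero m A f"
    and one_closed: "one \<in> A"
    and g_one: "p \<in> A \<Longrightarrow> g (p # replicate (n - 1) one) = p"

definition hyperideal ::
  "nat \<Rightarrow> nat \<Rightarrow> 'a set \<Rightarrow> ('a list \<Rightarrow> 'a set) \<Rightarrow> ('a list \<Rightarrow> 'a) \<Rightarrow> 'a set \<Rightarrow> bool" where
  "hyperideal m n A f g P \<longleftrightarrow>
     P \<noteq> {} \<and> P \<subseteq> A \<and>
     (\<forall>ps \<in> tuples m P. f ps \<subseteq> P) \<and>
     (\<forall>p\<in>P. hneg m A f p \<in> P) \<and>
     (\<forall>ps \<in> tuples n A. \<forall>i<n. \<forall>p\<in>P. g (ps[i := p]) \<in> P)"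

definition proper_hyperideal ::
  "nat \<Rightarrow> nat \<Rightarrow> 'a set \<Rightarrow> ('a list \<Rightarrow> 'a set) \<Rightarrow> ('a list \<Rightarrow> 'a) \<Rightarrow> 'a set \<Rightarrow> bool" where
  "proper_hyperideal m n A f g P \<longleftrightarrow> hyperideal m n A f g P \<and> P \<noteq> A"

definition nary_prime ::
  "nat \<Rightarrow> nat \<Rightarrow> 'a set \<Rightarrow> ('a list \<Rightarrow> 'a set) \<Rightarrow> ('a list \<Rightarrow> 'a) \<Rightarrow> 'a set \<Rightarrow> bool" where
  "nary_prime m n A f g P \<longleftrightarrow>
     proper_hyperideal m n A f g P \<and>
     (\<forall>ps \<in> tuples n A. g ps \<in> P \<longrightarrow> (\<exists>i<n. ps ! i \<in> P))"

definition minimal_nary_prime ::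
  "nat \<Rightarrow> nat \<Rightarrow> 'a set \<Rightarrow> ('a list \<Rightarrow> 'a set) \<Rightarrow> ('a list \<Rightarrow> 'a) \<Rightarrow> 'a set \<Rightarrow> bool" where
  "minimal_nary_prime m n A f g Q \<longleftrightarrow>
     nary_prime m n A f g Q \<and>
     (\<forall>Q'. nary_prime m n A f g Q' \<and> Q' \<subseteq> Q \<longrightarrow> Q' = Q)"

definition hradical ::
  "nat \<Rightarrow> nat \<Rightarrow> 'a set \<Rightarrow> ('a list \<Rightarrow> 'a set) \<Rightarrow> ('a list \<Rightarrow> 'a) \<Rightarrow> 'a set \<Rightarrow> 'a set" where
  "hradical m n A f g P =
     (if \<exists>Q. nary_prime m n A f g Q \<and> P \<subseteq> Q
      then \<Inter>{Q. nary_prime m n A f g Q \<and> P \<subseteq> Q} else A)"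

definition nary_multiplicative :: "nat \<Rightarrow> 'a set \<Rightarrow> ('a list \<Rightarrow> 'a) \<Rightarrow> 'a set \<Rightarrow> bool" where
  "nary_multiplicative n A g S \<longleftrightarrow>
     S \<noteq> {} \<and> S \<subseteq> A \<and> (\<forall>ss \<in> tuples n S. g ss \<in> S)"

definition nary_S_hyperideal ::
  "nat \<Rightarrow> nat \<Rightarrow> 'a set \<Rightarrow> ('a list \<Rightarrow> 'a set) \<Rightarrow> ('a list \<Rightarrow> 'a) \<Rightarrow> 'a \<Rightarrow> 'a set \<Rightarrow> 'a set \<Rightarrow> bool"
  where
  "nary_S_hyperideal m n A f g one S P \<longleftrightarrow>
     nary_multiplicative n A g S \<and>
     proper_hyperideal m n A f g P \<and>
     (\<forall>ps \<in> tuples n A. \<forall>i<n. g ps \<in> P \<and> ps ! i \<in> S \<longrightarrow> g (ps[i := one]) \<in> P)"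

text \<open>
  In the primary condition the index \<open>i\<close> is an arbitrary position: whenever
  $g(p_1^n) \in P$ and \<open>i\<close> is a position with $p_i \notin P$, the product with $p_i$ replaced
  by 1 lies in the radical. For $n = 2$ this is the usual condition that $ab \in P$ and
  $a \notin P$ imply $b \in r(P)$. Asking for the disjunction at one position only would not give
  the notion of a primary ideal: it would hold whenever the radical of \<open>P\<close> is prime,
  for example for the zero ideal of $k[x,y]/(x^2,xy)$.
\<close>

definition nary_primary ::
  "nat \<Rightarrow> nat \<Rightarrow> 'a set \<Rightarrow> ('a list \<Rightarrow> 'a set) \<Rightarrow> ('a list \<Rightarrow> 'a) \<Rightarrow> 'a \<Rightarrow> 'a set \<Rightarrow> bool" where
  "nary_primary m n A f g one P \<longleftrightarrow>
     proper_hyperideal m n A f g P \<and>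
     (\<forall>ps \<in> tuples n A. g ps \<in> P \<longrightarrow>
        (\<forall>i<n. ps ! i \<in> P \<or> g (ps[i := one]) \<in> hradical m n A f g P))"

definition nary_Q_primary ::
  "nat \<Rightarrow> nat \<Rightarrow> 'a set \<Rightarrow> ('a list \<Rightarrow> 'a set) \<Rightarrow> ('a list \<Rightarrow> 'a) \<Rightarrow> 'a \<Rightarrow> 'a set \<Rightarrow> 'a set \<Rightarrow> bool"
  where
  "nary_Q_primary m n A f g one Q P \<longleftrightarrow>
     nary_primary m n A f g one P \<and> hradical m n A f g P = Q"

end

theory Submission
  imports Defs
begin

text \<open>
  Everything reduces to the commutative monoid \<open>a \<cdot> b = g(a, b, 1, \<dots>, 1)\<close>, in which
  \<open>g\<close> is the iterated product. If \<open>P\<close> is an \<open>S\<close>-hyperideal, then \<open>P \<subseteq> Q\<close>, as an element of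
  \<open>P \<inter> S\<close> could be cancelled to give \<open>1 \<in> P\<close>. For \<open>q \<in> Q\<close> the multiplicative set
  \<open>{q\<^sup>k s | s \<in> S}\<close> must meet \<open>P\<close>, since otherwise a hyperideal maximal among those containing \<open>P\<close>
  and disjoint from it would be a prime strictly inside \<open>Q\<close>. Cancelling \<open>s\<close> gives
  \<open>q\<^sup>k \<in> P\<close>, so every prime over \<open>P\<close> contains \<open>Q\<close>, and the radical of \<open>P\<close> is \<open>Q\<close>.
\<close>

context comm_krasner_hyperring
begin

section \<open>The commutative binary monoid behind \<open>g\<close>\<close>

definition mul :: "'a \<Rightarrow> 'a \<Rightarrow> 'a" where
  "mul a b = g (a # b # replicate (n - 2) one)"

lemma mul_tuple: "a \<in> A \<Longrightarrow> b \<in> A \<Longrightarrow> a # b # replicate (n - 2) one \<in> tuples n A"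
  using n_ge_2 one_closed by (auto simp: tuples_def)

lemma mul_closed [simp]: "a \<in> A \<Longrightarrow> b \<in> A \<Longrightarrow> mul a b \<in> A"
  unfolding mul_def by (intro g_closed mul_tuple)

lemma mul_commute: "a \<in> A \<Longrightarrow> b \<in> A \<Longrightarrow> mul a b = mul b a"
  unfolding mul_def by (rule g_perm[OF mul_tuple]) auto

lemma mul_one: "a \<in> A \<Longrightarrow> mul a one = a"
proof -
  assume "a \<in> A"
  have "n - 1 = Suc (n - 2)" using n_ge_2 by simp
  then show ?thesis
    using g_one[OF \<open>a \<in> A\<close>] by (simp add: mul_def)
qed

lemma mul_assoc:
  assumes "a \<in> A" "b \<in> A" "c \<in> A"
  shows "mul (mul a b) c = mul a (mul b c)"
proof -
  obtain k where k: "n = Suc (Suc k)"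
    using n_ge_2 by (metis add_2_eq_Suc le_Suc_ex)
  have mul_eq: "mul x y = g (x # y # replicate k one)" for x y
    by (simp add: mul_def k[THEN arg_cong, of "\<lambda>n. n - 2"])
  let ?o = "replicate k one"
  \<comment> \<open>A word of length 2n - 1: bracketing at position 0 gives
    \<open>mul (mul a b) c\<close>, and at position 1 gives \<open>mul a (mul b c)\<close> up to the
    order of the inner arguments.\<close>
  let ?ps = "a # b # ?o @ c # ?o"
  have ps: "?ps \<in> tuples (2 * n - 1) A"
    using assms one_closed k by (auto simp: tuples_def)
  have "g (g (a # b # ?o) # c # ?o) = g (a # g (b # ?o @ [c]) # ?o)"
    using g_assoc[OF ps, of 0 1] k by simp
  moreover have "g (b # ?o @ [c]) = g (b # c # ?o)"
    by (rule g_perm) (use assms one_closed k in \<open>auto simp: tuples_def\<close>)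
  ultimately show ?thesis by (simp add: mul_eq)
qed

text \<open>The iterate \<open>(mul q ^^ k) s\<close> stands for q^k s; the power q^k itself is the
  case where \<open>s\<close> is \<open>one\<close>.\<close>

lemma mul_pow_closed: "q \<in> A \<Longrightarrow> s \<in> A \<Longrightarrow> (mul q ^^ k) s \<in> A"
  by (induction k) auto

lemma mul_pow_left:
  assumes "q \<in> A" "s \<in> A" "x \<in> A"
  shows "mul ((mul q ^^ k) s) x = (mul q ^^ k) (mul s x)"
  using assms by (induction k) (auto simp: mul_assoc mul_pow_closed)

text \<open>In the word made of \<open>a\<close>, n - 1 ones and \<open>ps\<close>, the first n
  entries collapse to \<open>a\<close> by \<open>g_one\<close>, while the last n form
  \<open>g (one # ps)\<close>. Associativity equates the two bracketings.\<close>

lemma g_Cons: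
  assumes "a # ps \<in> tuples n A"
  shows "g (a # ps) = mul a (g (one # ps))"
proof -
  obtain k where k: "n = Suc (Suc k)"
    using n_ge_2 by (metis add_2_eq_Suc le_Suc_ex)
  have mul_eq: "mul x y = g (x # y # replicate k one)" for x y
    by (simp add: mul_def k[THEN arg_cong, of "\<lambda>n. n - 2"])
  let ?o = "replicate (Suc k) one"
  have a: "a \<in> A" "length ps = Suc k" "set ps \<subseteq> A"
    using assms k by (auto simp: tuples_def)
  have qs: "a # ?o @ ps \<in> tuples (2 * n - 1) A"
    using a one_closed k by (auto simp: tuples_def)
  have "g (g (a # ?o) # ps) = g (a # replicate k one @ [g (one # ps)])"
    using g_assoc[OF qs, of 0 "Suc k"] a k
    by (simp add: replicate_append_same[symmetric] del: replicate_Suc)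
       (simp add: replicate_append_same)
  moreover have "g (a # ?o) = a" using g_one[OF a(1)] k by simp
  moreover have "g (one # ps) \<in> A"
    by (rule g_closed) (use a one_closed k in \<open>auto simp: tuples_def\<close>)
  moreover from this have
    "g (a # replicate k one @ [g (one # ps)]) = g (a # g (one # ps) # replicate k one)"
    by (intro g_perm) (use a one_closed k in \<open>auto simp: tuples_def\<close>)
  ultimately show ?thesis by (simp add: mul_eq)
qed

lemma g_update_tuple: "ps \<in> tuples n A \<Longrightarrow> x \<in> A \<Longrightarrow> ps[i := x] \<in> tuples n A"
  using set_update_subset_insert[of ps i x] by (auto simp: tuples_def)

text \<open>Permuting entry \<open>i\<close> to the front reduces this to \<open>g_Cons\<close>. The
  second factor is the element named in the conditions for S-hyperideals and primary hyperideals, so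
  both become conditions on \<open>mul\<close>.\<close>

lemma g_split:
  assumes ps: "ps \<in> tuples n A" and i: "i < n"
  shows "g ps = mul (ps ! i) (g (ps[i := one]))"
proof -
  let ?r = "take i ps @ drop (Suc i) ps"
  have len: "i < length ps" using ps i by (auto simp: tuples_def)
  have eq: "ps = take i ps @ ps ! i # drop (Suc i) ps"
    using len by (simp add: id_take_nth_drop)
  have upd: "ps[i := one] = take i ps @ one # drop (Suc i) ps"
    using len by (simp add: upd_conv_take_nth_drop)
  have m: "mset (ps ! i # ?r) = mset ps"
    by (subst (4) eq) simp
  have t: "ps ! i # ?r \<in> tuples n A"
    using ps m by (metis (mono_tags) mem_Collect_eq mset_eq_length mset_eq_setD tuples_def)
  have "g ps = g (ps ! i # ?r)"
    using g_perm[OF ps m] by simp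
  also have "\<dots> = mul (ps ! i) (g (one # ?r))"
    by (rule g_Cons[OF t])
  also have "g (one # ?r) = g (ps[i := one])"
    by (rule g_perm[OF g_update_tuple[OF ps one_closed]]) (simp add: upd)
  finally show ?thesis .
qed

text \<open>Start from the tuple of ones, whose value is \<open>one\<close>, and exchange ones for
  entries of \<open>ps\<close>. By \<open>g_Cons\<close> each exchange multiplies the value by an
  element of \<open>T\<close>.\<close>

lemma g_mem_mul_closed:
  assumes T: "T \<subseteq> A" "one \<in> T" "\<And>a b. a \<in> T \<Longrightarrow> b \<in> T \<Longrightarrow> mul a b \<in> T"
    and ps: "ps \<in> tuples n T"
  shows "g ps \<in> T"
proof -
  have "g (xs @ replicate (n - length xs) one) \<in> T"
    if "length xs \<le> n" "set xs \<subseteq> T" for xs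
    using that
  proof (induction xs)
    case Nil
    have "n = Suc (n - 1)" using n_ge_2 by simp
    then have "g (replicate n one) = one"
      using g_one[OF one_closed] by (metis replicate_Suc)
    then show ?case using T by simp
  next
    case (Cons x xs)
    let ?r = "xs @ replicate (n - length (x # xs)) one"
    have t: "x # ?r \<in> tuples n A"
      using Cons.prems T one_closed by (auto simp: tuples_def)
    have "n - length xs = Suc (n - length (x # xs))" using Cons.prems by simp
    then have "mset (xs @ replicate (n - length xs) one) = mset (one # ?r)"
      by (simp del: replicate_0)
    moreover have "one # ?r \<in> tuples n A"
      using t one_closed by (auto simp: tuples_def)
    ultimately have "g (xs @ replicate (n - length xs) one) = g (one # ?r)"
      by (intro g_perm)
    moreover have "g (xs @ replicate (n - length xs) one) \<in> T"
      using Cons by simp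
    ultimately have "g (one # ?r) \<in> T" by simp
    then show ?case
      using g_Cons[OF t] T(3) Cons.prems by simp
  qed
  from this[of ps] ps show ?thesis by (simp add: tuples_def)
qed

section \<open>Zero, negatives and distributivity for \<open>mul\<close>\<close>

lemma hzero_is: "is_hzero m A f (hzero m A f)"
  unfolding hzero_def by (rule theI'[OF zero_ex1])

lemma hneg_is: "p \<in> A \<Longrightarrow> is_hneg m A f p (hneg m A f p)"
  unfolding hneg_def by (rule theI'[OF neg_ex1])

lemma hneg_eqI: "p \<in> A \<Longrightarrow> is_hneg m A f p q \<Longrightarrow> hneg m A f p = q"
  using hneg_is neg_ex1 by blast

lemma mul_distrib:
  assumes "b \<in> A" "qs \<in> tuples m A"
  shows "(\<lambda>x. mul x b) ` f qs = f (map (\<lambda>q. mul q b) qs)"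
  using g_distrib[OF mul_tuple[OF one_closed assms(1)] assms(2), of 0] n_ge_2
  by (simp add: mul_def)

lemma mul_hzero: "b \<in> A \<Longrightarrow> mul (hzero m A f) b = hzero m A f"
  unfolding mul_def
  by (rule g_zero) (use n_ge_2 one_closed in \<open>auto simp: tuples_def\<close>)

text \<open>Multiplying the relation that defines the negative of \<open>p\<close> by
  \<open>b\<close> keeps zero on its left side, so uniqueness of negatives applies to
  \<open>mul p b\<close>.\<close>

lemma mul_hneg:
  assumes "p \<in> A" "b \<in> A"
  shows "mul (hneg m A f p) b = hneg m A f (mul p b)"
proof -
  let ?z = "hzero m A f" and ?q = "hneg m A f p"
  have z: "?z \<in> A" using hzero_is by (simp add: is_hzero_def)
  have q: "?q \<in> A" "?z \<in> f (p # ?q # replicate (m - 2) ?z)"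
    using hneg_is[OF assms(1)] by (auto simp: is_hneg_def)
  have t: "p # ?q # replicate (m - 2) ?z \<in> tuples m A"
    using z q assms m_ge_2 by (auto simp: tuples_def)
  have "mul ?z b \<in> f (map (\<lambda>q. mul q b) (p # ?q # replicate (m - 2) ?z))"
    using mul_distrib[OF assms(2) t] q(2) by blast
  then have "is_hneg m A f (mul p b) (mul ?q b)"
    using assms q by (simp add: is_hneg_def mul_hzero)
  then show ?thesis using hneg_eqI assms by simp
qed

section \<open>Hyperideals, primes and colons in terms of \<open>mul\<close>\<close>

lemma hyperideal_mul:
  assumes "hyperideal m n A f g I" "p \<in> I" "x \<in> A"
  shows "mul p x \<in> I"
proof -
  have "g ((one # x # replicate (n - 2) one)[0 := p]) \<in> I"
    using assms mul_tuple[OF one_closed assms(3)] n_ge_2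
    unfolding hyperideal_def by (meson less_le_trans zero_less_numeral)
  then show ?thesis by (simp add: mul_def)
qed

lemma proper_hyperideal_one:
  assumes "proper_hyperideal m n A f g I"
  shows "one \<notin> I"
proof
  assume "one \<in> I"
  then have "x \<in> I" if "x \<in> A" for x
    using hyperideal_mul[of I one x] assms that one_closed mul_commute[of one x] mul_one
    by (simp add: proper_hyperideal_def)
  then show False
    using assms by (auto simp: proper_hyperideal_def hyperideal_def)
qed

text \<open>The position supplied by n-ary primality cannot be one of the padding ones, since a
  proper hyperideal does not contain \<open>one\<close>.\<close>

lemma nary_prime_mul:
  assumes "nary_prime m n A f g I" "a \<in> A" "b \<in> A" "mul a b \<in> I"
  shows "a \<in> I \<or> b \<in> I"
proof -
  let ?ps = "a # b # replicate (n - 2) one"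
  obtain i where "i < n" "?ps ! i \<in> I"
    using assms mul_tuple[OF assms(2,3)] unfolding nary_prime_def mul_def by blast
  moreover have "length ?ps = n" using n_ge_2 by simp
  ultimately have "\<exists>x \<in> set ?ps. x \<in> I"
    by (metis nth_mem)
  moreover have "one \<notin> I"
    using proper_hyperideal_one assms(1) by (simp add: nary_prime_def)
  ultimately show ?thesis by auto
qed

text \<open>The colon (I : b) is the preimage of \<open>I\<close> under multiplication by
  \<open>b\<close>, which commutes with \<open>f\<close> and with negation by
  \<open>mul_distrib\<close> and \<open>mul_hneg\<close>. Absorption follows by moving the extra
  factor past \<open>b\<close>.\<close>

lemma hyperideal_colon:
  assumes I: "hyperideal m n A f g I" and b: "b \<in> A"
  shows "hyperideal m n A f g {x \<in> A. mul x b \<in> I}"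
  unfolding hyperideal_def
proof (intro conjI ballI allI impI)
  let ?C = "{x \<in> A. mul x b \<in> I}"
  have IA: "I \<subseteq> A" "I \<noteq> {}" using I by (auto simp: hyperideal_def)
  show "?C \<noteq> {}"
    using IA hyperideal_mul[OF I _ b] by blast
  show "?C \<subseteq> A" by auto
  show "f ps \<subseteq> ?C" if "ps \<in> tuples m ?C" for ps
  proof -
    have ps: "ps \<in> tuples m A" and "map (\<lambda>q. mul q b) ps \<in> tuples m I"
      using that by (auto simp: tuples_def)
    then have "f (map (\<lambda>q. mul q b) ps) \<subseteq> I"
      using I by (auto simp: hyperideal_def)
    then have "(\<lambda>x. mul x b) ` f ps \<subseteq> I"
      using mul_distrib[OF b ps] by simp
    then show ?thesis using f_closed[OF ps] by auto
  qed
  show "hneg m A f p \<in> ?C" if "p \<in> ?C" for p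
    using that I b mul_hneg[of p b] hneg_is[of p]
    by (auto simp: hyperideal_def is_hneg_def)
  show "g (ps[i := p]) \<in> ?C" if "ps \<in> tuples n A" "i < n" "p \<in> ?C" for ps i p
  proof -
    let ?u = "g (ps[i := one])"
    have t: "ps[i := p] \<in> tuples n A" and u: "?u \<in> A"
      using that g_update_tuple g_closed one_closed by auto
    have "length ps = n" using that by (simp add: tuples_def)
    then have eq: "g (ps[i := p]) = mul p ?u"
      using g_split[OF t that(2)] that by simp
    have "mul (mul p ?u) b = mul (mul p b) ?u"
      using that u b mul_assoc mul_commute by simp
    then show ?thesis
      using eq hyperideal_mul[OF I _ u, of "mul p b"] that u by simp
  qed
qed

lemma subset_hyperideal_colon:
  assumes "hyperideal m n A f g I" "b \<in> A"
  shows "I \<subseteq> {x \<in> A. mul x b \<in> I}"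
  using assms hyperideal_mul by (auto simp: hyperideal_def)

section \<open>Zorn's lemma and primes disjoint from a multiplicative set\<close>

lemma hyperideal_Union_chain:
  assumes C: "C \<noteq> {}" "subset.chain UNIV C" and I: "\<And>I. I \<in> C \<Longrightarrow> hyperideal m n A f g I"
  shows "hyperideal m n A f g (\<Union>C)"
  unfolding hyperideal_def
proof (intro conjI ballI allI impI)
  show "\<Union>C \<noteq> {}" using C(1) I unfolding hyperideal_def by blast
  show "\<Union>C \<subseteq> A" using I unfolding hyperideal_def by blast
  show "f ps \<subseteq> \<Union>C" if "ps \<in> tuples m (\<Union>C)" for ps
  proof -
    have "set ps \<subseteq> \<Union>C" using that by (simp add: tuples_def)
    \<comment> \<open>Closure under \<open>f\<close> is the one condition that involves several
      elements of the union; a tuple is finite, so one member of the chain contains all its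
      entries.\<close>
    then obtain J where "J \<in> C" "set ps \<subseteq> J"
      using finite_subset_Union_chain[OF finite_set _ C] by blast
    then have "f ps \<subseteq> J"
      using I[of J] that by (auto simp: hyperideal_def tuples_def)
    then show ?thesis using \<open>J \<in> C\<close> by auto
  qed
  show "hneg m A f p \<in> \<Union>C" if "p \<in> \<Union>C" for p
    using I that unfolding hyperideal_def by blast
  show "g (ps[i := p]) \<in> \<Union>C" if "ps \<in> tuples n A" "i < n" "p \<in> \<Union>C" for ps i p
    using I that unfolding hyperideal_def by blast
qed

text \<open>
  Primality of the maximal hyperideal \<open>M\<close> is obtained from the colon hyperideals \<open>(M : b)\<close>,
  which avoids describing the hyperideal generated by \<open>M\<close> and an element.
\<close>

lemma exists_prime_disjoint:
  assumes I: "hyperideal m n A f g I"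
    and T: "T \<subseteq> A" "one \<in> T" "\<And>a b. a \<in> T \<Longrightarrow> b \<in> T \<Longrightarrow> mul a b \<in> T"
    and disj: "I \<inter> T = {}"
  obtains M where "nary_prime m n A f g M" "I \<subseteq> M" "M \<inter> T = {}"
proof -
  define F where "F = {J. hyperideal m n A f g J \<and> I \<subseteq> J \<and> J \<inter> T = {}}"
  have "\<exists>M\<in>F. \<forall>X\<in>F. M \<subseteq> X \<longrightarrow> X = M"
  proof (rule subset_Zorn_nonempty)
    show "F \<noteq> {}" using I disj by (auto simp: F_def)
    show "\<Union>C \<in> F" if "C \<noteq> {}" "subset.chain F C" for C
    proof -
      have sub: "C \<subseteq> F" and ch: "subset.chain UNIV C"
        using that by (auto simp: subset.chain_def)
      have "hyperideal m n A f g (\<Union>C)"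
        by (rule hyperideal_Union_chain[OF that(1) ch]) (use sub in \<open>auto simp: F_def\<close>)
      then show ?thesis
        using sub that(1) unfolding F_def by blast
    qed
  qed
  then obtain M where MF: "M \<in> F" and max: "\<And>X. X \<in> F \<Longrightarrow> M \<subseteq> X \<Longrightarrow> X = M"
    by blast
  have M: "hyperideal m n A f g M" "I \<subseteq> M" "M \<inter> T = {}"
    using MF by (auto simp: F_def)
  have MA: "M \<subseteq> A" using M(1) by (simp add: hyperideal_def)
  \<comment> \<open>Maximality: (M : b) contains \<open>M\<close>, so it equals \<open>M\<close> as
    soon as it avoids \<open>T\<close>.\<close>
  have colon: "{x \<in> A. mul x b \<in> M} = M"
    if "b \<in> A" "{x \<in> A. mul x b \<in> M} \<inter> T = {}" for b
    using that max hyperideal_colon[OF M(1) that(1)]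
      subset_hyperideal_colon[OF M(1) that(1)] M(2) unfolding F_def by blast
  \<comment> \<open>For \<open>t\<close> in \<open>T\<close>, the colon (M : t) avoids
    \<open>T\<close>: an element of both would have its product with \<open>t\<close> in
    \<open>M\<close> and in \<open>T\<close>.\<close>
  have cancel: "x \<in> M" if "x \<in> A" "t \<in> T" "mul x t \<in> M" for x t
  proof -
    have "{x \<in> A. mul x t \<in> M} \<inter> T = {}"
      using T(3) that(2) M(3) by blast
    then show ?thesis using colon[of t] that T(1) by blast
  qed
  have prime: "mul a b \<in> A - M" if "a \<in> A - M" "b \<in> A - M" for a b
  proof -
    have False if ab: "mul a b \<in> M"
    proof -
      \<comment> \<open>The colon (M : b) contains \<open>a\<close>, which is outside
        \<open>M\<close>, so it must meet \<open>T\<close> in some \<open>t\<close>. Cancelling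
        \<open>t\<close> from the product of \<open>b\<close> and \<open>t\<close> would put
        \<open>b\<close> into \<open>M\<close>.\<close>
      have "{x \<in> A. mul x b \<in> M} \<noteq> M"
        using ab \<open>a \<in> A - M\<close> by blast
      then obtain t where "t \<in> T" "mul t b \<in> M"
        using colon \<open>b \<in> A - M\<close> by blast
      moreover from this have "mul b t \<in> M"
        using mul_commute[of b t] T(1) \<open>b \<in> A - M\<close> by auto
      ultimately show False using cancel \<open>b \<in> A - M\<close> by blast
    qed
    then show ?thesis using that by auto
  qed
  have oneM: "one \<in> A - M" using T(2) M(3) one_closed by blast
  have "\<exists>i<n. ps ! i \<in> M" if ps: "ps \<in> tuples n A" "g ps \<in> M" for ps
  proof (rule ccontr)
    assume "\<not> ?thesis"
    then have "ps \<in> tuples n (A - M)"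
      using ps(1) by (auto simp: tuples_def in_set_conv_nth)
    then have "g ps \<in> A - M"
      by (intro g_mem_mul_closed[OF _ oneM prime]) auto
    then show False using ps by simp
  qed
  then have "nary_prime m n A f g M"
    using M(1) oneM by (auto simp: nary_prime_def proper_hyperideal_def)
  then show thesis using that M by blast
qed

section \<open>Powers and minimal primes\<close>

lemma minimal_prime_power_multiple:
  assumes Q: "minimal_nary_prime m n A f g Q"
    and P: "hyperideal m n A f g P" and q: "q \<in> Q"
  obtains s k where "s \<in> A - Q" "(mul q ^^ k) s \<in> P"
proof -
  have prime: "nary_prime m n A f g Q" using Q by (simp add: minimal_nary_prime_def)
  then have QA: "Q \<subseteq> A" and one: "one \<in> A - Q"
    using proper_hyperideal_one one_closed
    by (auto simp: nary_prime_def proper_hyperideal_def hyperideal_def)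
  have qA: "q \<in> A" using q QA by blast
  \<comment> \<open>Taking k = 0 shows that \<open>T\<close> contains \<open>A - Q\<close>, and k =
    1 with s = \<open>one\<close> that it contains \<open>q\<close>. Hence a prime disjoint from
    \<open>T\<close> lies inside \<open>Q\<close> and misses \<open>q\<close>.\<close>
  define T where "T = {(mul q ^^ k) s | k s. s \<in> A - Q}"
  note pow_closed = mul_pow_closed[OF qA] and pow_mul = mul_pow_left[OF qA]
  have "mul a b \<in> T" if ab: "a \<in> T" "b \<in> T" for a b
  proof -
    obtain k s l t where a: "a = (mul q ^^ k) s" and b: "b = (mul q ^^ l) t"
      and st: "s \<in> A - Q" "t \<in> A - Q"
      using ab unfolding T_def by blast
    have "mul a b = (mul q ^^ k) (mul b s)"
      using st pow_mul[of s b k] pow_closed[of t l] mul_commute[of s b] by (simp add: a b)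
    also have "\<dots> = (mul q ^^ (k + l)) (mul t s)"
      using st pow_mul[of t s l] by (simp add: b funpow_add)
    finally have "mul a b = (mul q ^^ (k + l)) (mul t s)" .
    moreover have "mul t s \<in> A - Q"
      using st nary_prime_mul[OF prime] by auto
    ultimately show ?thesis unfolding T_def by blast
  qed
  moreover have T_pow: "(mul q ^^ k) s \<in> T" if "s \<in> A - Q" for k s
    using that unfolding T_def by blast
  moreover have "T \<subseteq> A" using pow_closed by (auto simp: T_def)
  moreover have "one \<in> T" using T_pow[OF one, of 0] by simp
  ultimately have "P \<inter> T \<noteq> {}"
  proof (intro notI)
    assume "P \<inter> T = {}" and T: "\<And>a b. a \<in> T \<Longrightarrow> b \<in> T \<Longrightarrow> mul a b \<in> T" "T \<subseteq> A" "one \<in> T"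
    then obtain M where M: "nary_prime m n A f g M" "M \<inter> T = {}"
      using exists_prime_disjoint[OF P] by metis
    have "M \<subseteq> A"
      using M(1) by (simp add: nary_prime_def proper_hyperideal_def hyperideal_def)
    then have "M \<subseteq> Q" using M(2) T_pow[of _ 0] by fastforce
    moreover have "q \<in> T" using T_pow[OF one, of 1] mul_one[OF qA] by simp
    ultimately show False
      using Q M q unfolding minimal_nary_prime_def by blast
  qed
  then show thesis using that unfolding T_def by blast
qed

lemma nary_prime_pow:
  assumes "nary_prime m n A f g I" "q \<in> A" "(mul q ^^ k) one \<in> I"
  shows "q \<in> I"
  using assms(3)
proof (induction k)
  case 0
  then show ?case
    using assms(1) proper_hyperideal_one by (simp add: nary_prime_def)
next
  case (Suc k)
  have "(mul q ^^ k) one \<in> A" using mul_pow_closed[OF assms(2) one_closed] .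
  then show ?case
    using Suc nary_prime_mul[OF assms(1,2)] by auto
qed

section \<open>The two conditions in binary form, and the radical\<close>

lemma nary_multiplicative_compl_prime:
  assumes "nary_prime m n A f g Q"
  shows "nary_multiplicative n A g (A - Q)"
proof -
  have one: "one \<in> A - Q"
    using assms proper_hyperideal_one one_closed by (simp add: nary_prime_def)
  have "mul a b \<in> A - Q" if "a \<in> A - Q" "b \<in> A - Q" for a b
    using that nary_prime_mul[OF assms] by auto
  then have "g ss \<in> A - Q" if "ss \<in> tuples n (A - Q)" for ss
    using g_mem_mul_closed[OF _ one _ that] by blast
  then show ?thesis using one unfolding nary_multiplicative_def by blast
qed

text \<open>Applied at position 0 of the padded pair, the defining condition becomes a cancellation
  law modulo \<open>P\<close> for elements of \<open>S\<close>.\<close>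

lemma nary_S_hyperideal_cancel:
  assumes "nary_S_hyperideal m n A f g one S P" "s \<in> S" "s \<in> A" "x \<in> A" "mul s x \<in> P"
  shows "x \<in> P"
proof -
  have "0 < n" using n_ge_2 by simp
  then have "g ((s # x # replicate (n - 2) one)[0 := one]) \<in> P"
    using assms mul_tuple[OF assms(3,4)] unfolding nary_S_hyperideal_def mul_def
    by (metis nth_Cons_0)
  then have "mul one x \<in> P" by (simp add: mul_def)
  then show ?thesis using mul_commute[OF one_closed assms(4)] mul_one[OF assms(4)] by simp
qed

lemma nary_primary_mul:
  assumes "nary_primary m n A f g one P" "a \<in> A" "b \<in> A" "mul a b \<in> P"
  shows "a \<in> P \<or> b \<in> hradical m n A f g P"
proof -
  have "0 < n" using n_ge_2 by simp
  then have "a \<in> P \<or> g ((a # b # replicate (n - 2) one)[0 := one]) \<in> hradical m n A f g P"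
    using assms mul_tuple[OF assms(2,3)] unfolding nary_primary_def mul_def
    by (metis nth_Cons_0)
  then have "a \<in> P \<or> mul one b \<in> hradical m n A f g P" by (simp add: mul_def)
  then show ?thesis using mul_commute[OF one_closed assms(3)] mul_one[OF assms(3)] by simp
qed

lemma hradical_eq_minimal_prime:
  assumes Q: "minimal_nary_prime m n A f g Q"
    and P: "nary_S_hyperideal m n A f g one (A - Q) P"
  shows "hradical m n A f g P = Q"
proof -
  have prime: "nary_prime m n A f g Q" using Q by (simp add: minimal_nary_prime_def)
  then have QA: "Q \<subseteq> A"
    by (simp add: nary_prime_def proper_hyperideal_def hyperideal_def)
  have proper: "proper_hyperideal m n A f g P"
    using P by (simp add: nary_S_hyperideal_def)
  then have hyp: "hyperideal m n A f g P" and PA: "P \<subseteq> A"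
    by (auto simp: proper_hyperideal_def hyperideal_def)
  have PQ: "P \<subseteq> Q"
  proof
    fix p assume p: "p \<in> P"
    show "p \<in> Q"
    proof (rule ccontr)
      assume "p \<notin> Q"
      then have "one \<in> P"
        using nary_S_hyperideal_cancel[OF P, of p one] p PA one_closed mul_one[of p] by auto
      then show False using proper_hyperideal_one[OF proper] by simp
    qed
  qed
  have "q \<in> I" if q: "q \<in> Q" and I: "nary_prime m n A f g I" "P \<subseteq> I" for q I
  proof -
    have qA: "q \<in> A" using q QA by blast
    obtain s k where s: "s \<in> A - Q" "(mul q ^^ k) s \<in> P"
      using minimal_prime_power_multiple[OF Q hyp q] .
    have pc: "(mul q ^^ k) one \<in> A" using mul_pow_closed[OF qA one_closed] .
    have "mul ((mul q ^^ k) one) s = (mul q ^^ k) s"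
      using mul_pow_left[OF qA one_closed, of s k] s(1) one_closed
        mul_commute[of one s] mul_one[of s] by simp
    then have "mul s ((mul q ^^ k) one) \<in> P"
      using s mul_commute[of s "(mul q ^^ k) one"] pc by simp
    then have "(mul q ^^ k) one \<in> P"
      using nary_S_hyperideal_cancel[OF P] s(1) pc by blast
    then show ?thesis using nary_prime_pow[OF I(1) qA] I(2) by blast
  qed
  \<comment> \<open>\<open>Q\<close> is itself a prime over \<open>P\<close>, so the intersection
    also lies in \<open>Q\<close>, and the default value \<open>A\<close> of the radical does not
    occur.\<close>
  then have "\<Inter>{I. nary_prime m n A f g I \<and> P \<subseteq> I} = Q"
    using prime PQ by blast
  then show ?thesis
    using prime PQ by (auto simp: hradical_def)
qed

text \<open>Once the radical is \<open>Q\<close>, \<open>g_split\<close> turns both conditions into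
  the same one: if a product of two factors is in \<open>P\<close>, one factor is in
  \<open>P\<close> or the other in \<open>Q\<close>. They differ in which factor takes which role,
  and \<open>mul_commute\<close> exchanges them. Minimality of \<open>Q\<close> enters through
  \<open>hradical_eq_minimal_prime\<close>.\<close>

lemma nary_S_hyperideal_iff_Q_primary:
  assumes Q: "minimal_nary_prime m n A f g Q"
  shows "nary_S_hyperideal m n A f g one (A - Q) P \<longleftrightarrow> nary_Q_primary m n A f g one Q P"
proof
  assume S: "nary_S_hyperideal m n A f g one (A - Q) P"
  note rad = hradical_eq_minimal_prime[OF Q S]
  have "ps ! i \<in> P \<or> g (ps[i := one]) \<in> Q"
    if ps: "ps \<in> tuples n A" "g ps \<in> P" "i < n" for ps i
  proof -
    have a: "ps ! i \<in> A" and b: "g (ps[i := one]) \<in> A"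
      using ps g_closed g_update_tuple one_closed by (auto simp: tuples_def)
    then have "mul (g (ps[i := one])) (ps ! i) \<in> P"
      using g_split[OF ps(1,3)] ps(2) mul_commute by simp
    then show ?thesis
      using nary_S_hyperideal_cancel[OF S, of "g (ps[i := one])" "ps ! i"] a b by blast
  qed
  then show "nary_Q_primary m n A f g one Q P"
    using S rad by (simp add: nary_Q_primary_def nary_primary_def nary_S_hyperideal_def)
next
  assume R: "nary_Q_primary m n A f g one Q P"
  then have prim: "nary_primary m n A f g one P" and rad: "hradical m n A f g P = Q"
    by (auto simp: nary_Q_primary_def)
  have "g (ps[i := one]) \<in> P"
    if ps: "ps \<in> tuples n A" "i < n" "g ps \<in> P" "ps ! i \<in> A - Q" for ps i
  proof -
    have b: "g (ps[i := one]) \<in> A"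
      using ps g_closed g_update_tuple one_closed by auto
    then have "mul (g (ps[i := one])) (ps ! i) \<in> P"
      using g_split[OF ps(1,2)] ps(3,4) mul_commute by simp
    then show ?thesis
      using nary_primary_mul[OF prim b] ps(4) rad by blast
  qed
  moreover have "nary_multiplicative n A g (A - Q)"
    using Q nary_multiplicative_compl_prime by (simp add: minimal_nary_prime_def)
  ultimately show "nary_S_hyperideal m n A f g one (A - Q) P"
    using prim by (simp add: nary_S_hyperideal_def nary_primary_def)
qed

end

theorem theorem3p11:
  fixes m n :: nat and A :: "'a set" and f :: "'a list \<Rightarrow> 'a set"
    and g :: "'a list \<Rightarrow> 'a" and one :: 'a and P Q S :: "'a set"
  assumes "comm_krasner_hyperring m n A f g one"
    and "proper_hyperideal m n A f g P"
    and "minimal_nary_prime m n A f g Q"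
    and "S = A - Q"
  shows "nary_S_hyperideal m n A f g one S P \<longleftrightarrow> nary_Q_primary m n A f g one Q P"
  using comm_krasner_hyperring.nary_S_hyperideal_iff_Q_primary[OF assms(1,3)] assms(4) by simp

end
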